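(* Let $D$ be a DEFiM that is sensible for the $\lambda$-calculus with $D$-tests $\Lambda_{\tau(D)}$. Then for every term $M\in\Lambda_{\tau(D)}$ with free variables among $\vec x=x_1,\dots,x_n$, every $\vec\alpha\in D^n$ and every $\beta\in D$: $$(\vec\alpha,\beta)\in[\![M]\!]^{\vec x}\iff \tau_\beta\big(M[\bar\epsilon_{\alpha_1}/x_1,\dots,\bar\epsilon_{\alpha_n}/x_n]\big)\Downarrow.$$
   Context: Filter models. A filter model is a triple $(D,\wedge,\to)$ where $(D,\wedge)$ is a meet-semilattice with top $\omega$ ($\alpha\ge_D\beta$ iff $\alpha\wedge\beta=\beta$) and $\to$ is a binary operation with: for every finite family $(\alpha_i,\beta_i)_i$ and all $\gamma,\delta$, $\gamma\to\delta\ge_D\bigwedge_i(\alpha_i\to\beta_i)$ iff $\delta\ge_D\bigwedge_{\{i\mid\gamma\le_D\alpha_i\}}\beta_i$ (empty meet $=\omega$). Extensional: a function $\mathrm{ext}_D$ gives each $\alpha$ a finite $\mathrm{ext}_D(\alpha)\subseteq D\times D$ with $\alpha=\bigwedge_{(\beta,\gamma)\in\mathrm{ext}_D(\alpha)}(\beta\to\gamma)$. Distributive: whenever $\alpha\ge_D\beta\wedge\gamma$ there are $\beta'\ge_D\beta,\gamma'\ge_D\gamma$ with $\alpha=\beta'\wedge\gamma'$. DEFiM = distributive extensional filter model with fixed $\mathrm{ext}_D$. Calculus $\Lambda_{\tau(D)}$: terms $M::=x\mid\lambda x.M\mid MN\mid\sum_{i\le n}\bar\tau_{\alpha_i}(Q_i)$,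 tests $Q::=\sum_{i\le n}Q_i\mid\prod_{i\le n}Q_i\mid\tau_\alpha(M)$ ($\alpha,\alpha_i\in D\setminus\{\omega\}$, $n\ge0$); sums/products are finite multisets, empty sum $\mathbf 0$, empty product $\epsilon$, $\bar\epsilon_\alpha:=\bar\tau_\alpha(\epsilon)$, $\tau_\omega(M):=\epsilon$, $\bar\epsilon_\omega:=\mathbf 0$. Rules: $(\lambda x.M)N\to M[N/x]$; $(\sum_i\bar\tau_{\alpha_i}(Q_i))N\to\sum_i\sum_{(\beta,\gamma)\in\mathrm{ext}_D(\alpha_i)}\bar\tau_\gamma(Q_i\cdot\tau_\beta(N))$; $\tau_\alpha(\lambda x.M)\to\prod_{(\beta,\gamma)\in\mathrm{ext}_D(\alpha)}\tau_\gamma(M[\bar\epsilon_\beta/x])$; $\tau_\alpha(\sum_{i\in I}\bar\tau_{\beta_i}(Q_i))\to\sum_{\{I'\subseteq I\mid\alpha\ge_D\bigwedge_{i\in I'}\beta_i\}}\prod_{i\in I'}Q_i$; $\prod_{i}\sum_{j\le k_i}Q_{i,j}\to\sum_{j_1,\dots,j_n}\prod_iQ_{i,j_i}$; $\bar\tau_\alpha(\sum_iQ_i)\to\sum_i\bar\tau_\alpha(Q_i)$. Head reduction $\to_h$: closure of these under $\lambda x.[\cdot]$; $[\cdot]N$ and $\tau_\alpha([\cdot])$ when the reduced term is an application; $\bar\tau_\alpha([\cdot])$ and $[\cdot]\cdot P$ when the reduced test is not a sum; $[\cdot]+N$ for terms and $[\cdot]+P$ for tests. May-head-normal forms: tests $\prod_i\tau_{\alpha_i}(x_iM_i^1\cdots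 M_i^{n_i})+Q$; terms $\lambda x_1..x_n.y\,M_1\cdots M_m$ or $\lambda x_1..x_n.\bar\tau_\alpha(Q)+N$ with $\alpha\neq\omega$, $Q$ a head-normal test without sums. $\Downarrow$: head-reduces to a may-head-normal form; $\Uparrow$: not $\Downarrow$. Interpretation, for free variables among $\vec x$: $[\![x_i]\!]^{\vec x}=\{(\vec\alpha,\beta)\mid\beta\ge_D\alpha_i\}$; $[\![\lambda y.M]\!]^{\vec x}=\{(\vec\alpha,\bigwedge_i(\beta_i\to\gamma_i))\mid\forall i,(\vec\alpha\beta_i,\gamma_i)\in[\![M]\!]^{\vec xy}\}$; $[\![MN]\!]^{\vec x}=\{(\vec\alpha,\bigwedge_i\beta_i)\mid\exists(\gamma_i)_i,(\vec\alpha,\bigwedge_i(\gamma_i\to\beta_i))\in[\![M]\!]^{\vec x},(\vec\alpha,\bigwedge_i\gamma_i)\in[\![N]\!]^{\vec x}\}$; $[\![\sum_{i\in J}\bar\tau_{\alpha_i}(Q_i)]\!]^{\vec x}=\{(\vec\beta,\gamma)\mid\exists I\subseteq J,\vec\beta\in\bigcap_{i\in I}[\![Q_i]\!]^{\vec x},\gamma\ge_D\bigwedge_{i\in I}\alpha_i\}$; $[\![\tau_\alpha(M)]\!]^{\vec x}=\{\vec\beta\mid(\vec\beta,\alpha)\in[\![M]\!]^{\vec x}\}$; products of tests are intersections ($[\![\epsilon]\!]=D^{\vec x}$), sums of tests unions ($[\![\mathbf 0]\!]=\emptyset$). $D$ is sensible for $\Lambda_{\tau(D)}$ if for all terms $M$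 and tests $Q$: $M\Uparrow$ iff $[\![M]\!]^{\vec x}=\{(\vec\alpha,\omega)\mid\vec\alpha\}$, and $Q\Uparrow$ iff $[\![Q]\!]^{\vec x}=\emptyset$. *)

theory Defs
  imports "HOL-Library.Multiset"
begin

section \<open>Filter models\<close>

text \<open>
  The carrier \<open>D\<close> is a type of class \<^class>\<open>bounded_semilattice_inf_top\<close>: the meet is
  \<^const>\<open>inf\<close> and \<open>\<omega>\<close> is \<^const>\<open>top\<close>.  Finite families are finite multisets.
\<close>

definition Meet :: "'d::bounded_semilattice_inf_top multiset \<Rightarrow> 'd" where
  "Meet A = fold_mset inf top A"

locale filter_model =
  fixes arr :: "'d::bounded_semilattice_inf_top \<Rightarrow> 'd \<Rightarrow> 'd"
  assumes arr_ge_Meet_iff: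
    "Meet {#arr \<alpha> \<beta>. (\<alpha>, \<beta>) \<in># F#} \<le> arr \<gamma> \<delta> \<longleftrightarrow>
     Meet {#\<beta>. (\<alpha>, \<beta>) \<in># filter_mset (\<lambda>(\<alpha>, \<beta>). \<gamma> \<le> \<alpha>) F#} \<le> \<delta>"

locale extensional_filter_model = filter_model arr
  for arr :: "'d::bounded_semilattice_inf_top \<Rightarrow> 'd \<Rightarrow> 'd" +
  fixes ext :: "'d \<Rightarrow> ('d \<times> 'd) set"
  assumes finite_ext: "finite (ext \<alpha>)"
    and ext_eq: "\<alpha> = Meet {#arr \<beta> \<gamma>. (\<beta>, \<gamma>) \<in># mset_set (ext \<alpha>)#}"

locale DEFiM = extensional_filter_model arr ext
  for arr :: "'d::bounded_semilattice_inf_top \<Rightarrow> 'd \<Rightarrow> 'd"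
    and ext :: "'d \<Rightarrow> ('d \<times> 'd) set" +
  assumes distributive: "inf \<beta> \<gamma> \<le> (\<alpha> :: 'd) \<Longrightarrow> \<exists>\<beta>' \<gamma>'. \<beta> \<le> \<beta>' \<and> \<gamma> \<le> \<gamma>' \<and> \<alpha> = inf \<beta>' \<gamma>'"


section \<open>Terms and tests\<close>

text \<open>
  Variables are de Bruijn indices.  \<open>BarSum {#(\<alpha>\<^sub>1, Q\<^sub>1), \<dots>, (\<alpha>\<^sub>n, Q\<^sub>n)#}\<close> is the term
  \<open>\<Sum>\<^sub>i bar_\<alpha>\<^sub>i(Q\<^sub>i)\<close>, where \<open>bar\<close> stands for the barred \<open>\<tau>\<close>.
\<close>

datatype 'd trm =
    Var nat
  | Lam "'d trm"
  | App "'d trm" "'d trm"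
  | BarSum "('d \<times> 'd tst) multiset"
and 'd tst =
    TSum "'d tst multiset"
  | TProd "'d tst multiset"
  | Tau 'd "'d trm"

fun is_app :: "'d trm \<Rightarrow> bool" where
  "is_app (App M N) = True"
| "is_app _ = False"

fun is_sum :: "'d tst \<Rightarrow> bool" where
  "is_sum (TSum S) = True"
| "is_sum _ = False"

fun is_prod :: "'d tst \<Rightarrow> bool" where
  "is_prod (TProd P) = True"
| "is_prod _ = False"

text \<open>
  Sums and products of tests being multisets, a sum of sums is the sum of all the summands and a
  sum with one summand is that summand; likewise for products.  Each class of tests modulo these
  identifications has one representative in which no sum is a summand of a sum, no product is a
  factor of a product, and no sum or product has exactly one member.  The predicates below select
  these representatives, and the operations \<open>tsum\<close> and \<open>tprod\<close> compute sums and products of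
  representatives.

  \<open>is_trm n M\<close> says that \<open>M\<close> is a term of the calculus with free variables among the first \<open>n\<close>
  indices.
\<close>

inductive is_trm :: "nat \<Rightarrow> 'd::bounded_semilattice_inf_top trm \<Rightarrow> bool"
  and is_tst :: "nat \<Rightarrow> 'd tst \<Rightarrow> bool" where
  "i < n \<Longrightarrow> is_trm n (Var i)"
| "is_trm (Suc n) M \<Longrightarrow> is_trm n (Lam M)"
| "is_trm n M \<Longrightarrow> is_trm n N \<Longrightarrow> is_trm n (App M N)"
| "(\<And>\<alpha> Q. (\<alpha>, Q) \<in># S \<Longrightarrow> \<alpha> \<noteq> top \<and> is_tst n Q) \<Longrightarrow> is_trm n (BarSum S)"
| "(\<And>Q. Q \<in># S \<Longrightarrow> is_tst n Q \<and> \<not> is_sum Q) \<Longrightarrow> size S \<noteq> 1 \<Longrightarrow> is_tst n (TSum S)"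
| "(\<And>Q. Q \<in># P \<Longrightarrow> is_tst n Q \<and> \<not> is_prod Q) \<Longrightarrow> size P \<noteq> 1 \<Longrightarrow> is_tst n (TProd P)"
| "\<alpha> \<noteq> top \<Longrightarrow> is_trm n M \<Longrightarrow> is_tst n (Tau \<alpha> M)"

fun summands :: "'d tst \<Rightarrow> 'd tst multiset" where
  "summands (TSum S) = S"
| "summands Q = {#Q#}"

fun factors :: "'d tst \<Rightarrow> 'd tst multiset" where
  "factors (TProd P) = P"
| "factors Q = {#Q#}"

definition tsum :: "'d tst multiset \<Rightarrow> 'd tst" where
  "tsum S = (let T = \<Sum>\<^sub># (image_mset summands S)
             in if \<exists>Q. T = {#Q#} then THE Q. T = {#Q#} else TSum T)"

definition tprod :: "'d tst multiset \<Rightarrow> 'd tst" where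
  "tprod P = (let T = \<Sum>\<^sub># (image_mset factors P)
              in if \<exists>Q. T = {#Q#} then THE Q. T = {#Q#} else TProd T)"

abbreviation eps :: "'d tst" where
  "eps \<equiv> TProd {#}"

text \<open>The operators with index \<open>\<omega>\<close>: \<open>\<tau>\<^sub>\<omega>(M) = \<epsilon>\<close>, and \<open>bar_\<omega>(Q)\<close> is the empty sum of terms.\<close>

definition tau :: "'d::bounded_semilattice_inf_top \<Rightarrow> 'd trm \<Rightarrow> 'd tst" where
  "tau \<alpha> M = (if \<alpha> = top then eps else Tau \<alpha> M)"

definition barsum :: "('d::bounded_semilattice_inf_top \<times> 'd tst) multiset \<Rightarrow> 'd trm" where
  "barsum S = BarSum (filter_mset (\<lambda>(\<alpha>, Q). \<alpha> \<noteq> top) S)"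

definition ebar :: "'d::bounded_semilattice_inf_top \<Rightarrow> 'd trm" where
  "ebar \<alpha> = barsum {#(\<alpha>, eps)#}"


section \<open>Substitution\<close>

primrec rename_trm :: "'d trm \<Rightarrow> (nat \<Rightarrow> nat) \<Rightarrow> 'd trm"
  and rename_tst :: "'d tst \<Rightarrow> (nat \<Rightarrow> nat) \<Rightarrow> 'd tst" where
  "rename_trm (Var i) r = Var (r i)"
| "rename_trm (Lam M) r = Lam (rename_trm M (case_nat 0 (Suc \<circ> r)))"
| "rename_trm (App M N) r = App (rename_trm M r) (rename_trm N r)"
| "rename_trm (BarSum S) r = BarSum (image_mset (map_prod id (\<lambda>Q. rename_tst Q r)) S)"
| "rename_tst (TSum S) r = TSum (image_mset (\<lambda>Q. rename_tst Q r) S)"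
| "rename_tst (TProd P) r = TProd (image_mset (\<lambda>Q. rename_tst Q r) P)"
| "rename_tst (Tau \<alpha> M) r = Tau \<alpha> (rename_trm M r)"

definition up :: "(nat \<Rightarrow> 'd trm) \<Rightarrow> nat \<Rightarrow> 'd trm" where
  "up s = case_nat (Var 0) (\<lambda>i. rename_trm (s i) Suc)"

primrec subst_trm :: "'d trm \<Rightarrow> (nat \<Rightarrow> 'd trm) \<Rightarrow> 'd trm"
  and subst_tst :: "'d tst \<Rightarrow> (nat \<Rightarrow> 'd trm) \<Rightarrow> 'd tst" where
  "subst_trm (Var i) s = s i"
| "subst_trm (Lam M) s = Lam (subst_trm M (up s))"
| "subst_trm (App M N) s = App (subst_trm M s) (subst_trm N s)"
| "subst_trm (BarSum S) s = BarSum (image_mset (map_prod id (\<lambda>Q. subst_tst Q s)) S)"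
| "subst_tst (TSum S) s = TSum (image_mset (\<lambda>Q. subst_tst Q s) S)"
| "subst_tst (TProd P) s = TProd (image_mset (\<lambda>Q. subst_tst Q s) P)"
| "subst_tst (Tau \<alpha> M) s = Tau \<alpha> (subst_trm M s)"

text \<open>
  \<open>inst M [N\<^sub>0, \<dots>, N\<^bsub>k-1\<^esub>]\<close> replaces the index \<open>i < k\<close> by \<open>N\<^sub>i\<close>, all at once, and removes these
  indices from the context.
\<close>

definition inst :: "'d trm \<Rightarrow> 'd trm list \<Rightarrow> 'd trm" where
  "inst M Ns = subst_trm M (\<lambda>i. if i < length Ns then Ns ! i else Var (i - length Ns))"


section \<open>Head reduction\<close>

text \<open>
  In the fourth rule the index set \<open>I\<close> is \<open>{..<length xs}\<close>.  In the fifth rule the factors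
  \<open>\<Sum>\<^sub>j Q\<^sub>i\<^sub>j\<close> are given by a list of lists; its premises say that every summand of each factor is listed,
  that some factor is a proper sum and that the product is proper, which excludes the identity
  instances; products are distributed
  in part through \<open>ctx_prod\<close>.
\<close>

inductive hred_trm :: "('d::bounded_semilattice_inf_top \<Rightarrow> ('d \<times> 'd) set) \<Rightarrow>
      'd trm \<Rightarrow> 'd trm \<Rightarrow> bool"
  and hred_tst :: "('d \<Rightarrow> ('d \<times> 'd) set) \<Rightarrow> 'd tst \<Rightarrow> 'd tst \<Rightarrow> bool"
  for ext :: "'d \<Rightarrow> ('d \<times> 'd) set" where
  beta: "hred_trm ext (App (Lam M) N) (inst M [N])"
| app_BarSum: "hred_trm ext (App (BarSum S) N)
    (barsum (\<Sum>(\<alpha>, Q)\<in>#S.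
      {#(\<gamma>, tprod {#Q, tau \<beta> N#}). (\<beta>, \<gamma>) \<in># mset_set (ext \<alpha>)#}))"
| Tau_Lam: "hred_tst ext (Tau \<alpha> (Lam M))
    (tprod {#tau \<gamma> (inst M [ebar \<beta>]). (\<beta>, \<gamma>) \<in># mset_set (ext \<alpha>)#})"
| Tau_BarSum: "hred_tst ext (Tau \<alpha> (BarSum (mset xs)))
    (tsum {#tprod {#snd (xs ! i). i \<in># mset_set I'#}.
      I' \<in># mset_set {I'. I' \<subseteq> {..<length xs} \<and> Meet {#fst (xs ! i). i \<in># mset_set I'#} \<le> \<alpha>}#})"
| TProd_TSum: "(\<And>Qs Q. Qs \<in> set Qss \<Longrightarrow> Q \<in> set Qs \<Longrightarrow> \<not> is_sum Q) \<Longrightarrow>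
    \<exists>Qs\<in>set Qss. length Qs \<noteq> 1 \<Longrightarrow> length Qss \<noteq> 1 \<Longrightarrow>
    hred_tst ext (TProd {#tsum (mset Qs). Qs \<in># mset Qss#})
      (tsum {#tprod (mset Cs). Cs \<in># mset (product_lists Qss)#})"
| BarSum_TSum: "hred_trm ext (BarSum {#(\<alpha>, TSum S)#}) (BarSum {#(\<alpha>, Q). Q \<in># S#})"
| ctx_Lam: "hred_trm ext M M' \<Longrightarrow> hred_trm ext (Lam M) (Lam M')"
| ctx_App: "hred_trm ext M M' \<Longrightarrow> is_app M \<Longrightarrow> hred_trm ext (App M N) (App M' N)"
| ctx_Tau: "hred_trm ext M M' \<Longrightarrow> is_app M \<Longrightarrow> hred_tst ext (Tau \<alpha> M) (Tau \<alpha> M')"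
| ctx_Bar: "hred_tst ext Q Q' \<Longrightarrow> \<not> is_sum Q \<Longrightarrow>
    hred_trm ext (BarSum {#(\<alpha>, Q)#}) (BarSum {#(\<alpha>, Q')#})"
| ctx_prod: "hred_tst ext Q Q' \<Longrightarrow> \<not> is_sum Q \<Longrightarrow>
    hred_tst ext (tprod {#Q, P#}) (tprod {#Q', P#})"
| ctx_BarSum: "hred_trm ext (BarSum S) (BarSum S') \<Longrightarrow>
    hred_trm ext (BarSum (S + T)) (BarSum (S' + T))"
| ctx_sum: "hred_tst ext Q Q' \<Longrightarrow> hred_tst ext (tsum {#Q, P#}) (tsum {#Q', P#})"

abbreviation lams :: "nat \<Rightarrow> 'd trm \<Rightarrow> 'd trm" where
  "lams n M \<equiv> (Lam ^^ n) M"

abbreviation apps :: "'d trm \<Rightarrow> 'd trm list \<Rightarrow> 'd trm" where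
  "apps M Ns \<equiv> foldl App M Ns"

text \<open>\<open>\<Prod>\<^sub>i \<tau>\<^bsub>\<alpha>\<^sub>i\<^esub>(x\<^sub>i M\<^sub>i\<^sup>1 \<dots> M\<^sub>i\<^sup>n)\<close>: the head-normal tests without sums.\<close>

definition hn_prod :: "'d::bounded_semilattice_inf_top tst \<Rightarrow> bool" where
  "hn_prod Q \<longleftrightarrow> (\<exists>P. (\<forall>R\<in>#P. \<exists>\<alpha> x Ms. \<alpha> \<noteq> top \<and> R = Tau \<alpha> (apps (Var x) Ms)) \<and> Q = tprod P)"

definition mhnf_tst :: "'d::bounded_semilattice_inf_top tst \<Rightarrow> bool" where
  "mhnf_tst R \<longleftrightarrow> (\<exists>P Q. hn_prod P \<and> R = tsum {#P, Q#})"

definition mhnf_trm :: "'d::bounded_semilattice_inf_top trm \<Rightarrow> bool" where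
  "mhnf_trm M \<longleftrightarrow>
     (\<exists>n y Ms. M = lams n (apps (Var y) Ms)) \<or>
     (\<exists>n \<alpha> Q S. M = lams n (BarSum (add_mset (\<alpha>, Q) S)) \<and> \<alpha> \<noteq> top \<and> hn_prod Q)"

definition conv_trm :: "('d::bounded_semilattice_inf_top \<Rightarrow> ('d \<times> 'd) set) \<Rightarrow> 'd trm \<Rightarrow> bool" where
  "conv_trm ext M \<longleftrightarrow> (\<exists>M'. (hred_trm ext)\<^sup>*\<^sup>* M M' \<and> mhnf_trm M')"

definition conv_tst :: "('d::bounded_semilattice_inf_top \<Rightarrow> ('d \<times> 'd) set) \<Rightarrow> 'd tst \<Rightarrow> bool" where
  "conv_tst ext Q \<longleftrightarrow> (\<exists>Q'. (hred_tst ext)\<^sup>*\<^sup>* Q Q' \<and> mhnf_tst Q')"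


section \<open>Interpretation\<close>

text \<open>
  \<open>interp_trm arr M n\<close> and \<open>interp_tst arr Q n\<close> are the interpretations in a context of \<open>n\<close>
  variables.  The vector \<open>as\<close> has length \<open>n\<close> and its entry \<open>as ! i\<close> belongs to the index \<open>i\<close>, so
  that the variable bound by \<open>Lam\<close> is put in front.
\<close>

primrec interp_trm :: "('d::bounded_semilattice_inf_top \<Rightarrow> 'd \<Rightarrow> 'd) \<Rightarrow>
      'd trm \<Rightarrow> nat \<Rightarrow> ('d list \<times> 'd) set"
  and interp_tst :: "('d \<Rightarrow> 'd \<Rightarrow> 'd) \<Rightarrow> 'd tst \<Rightarrow> nat \<Rightarrow> 'd list set" where
  "interp_trm arr (Var i) n = {(as, \<beta>). length as = n \<and> i < n \<and> as ! i \<le> \<beta>}"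
| "interp_trm arr (Lam M) n =
     {(as, Meet {#arr \<beta> \<gamma>. (\<beta>, \<gamma>) \<in># F#}) | as F.
        length as = n \<and> (\<forall>(\<beta>, \<gamma>)\<in>#F. (\<beta> # as, \<gamma>) \<in> interp_trm arr M (Suc n))}"
| "interp_trm arr (App M N) n =
     {(as, Meet {#\<beta>. (\<gamma>, \<beta>) \<in># F#}) | as F.
        (as, Meet {#arr \<gamma> \<beta>. (\<gamma>, \<beta>) \<in># F#}) \<in> interp_trm arr M n \<and>
        (as, Meet {#\<gamma>. (\<gamma>, \<beta>) \<in># F#}) \<in> interp_trm arr N n}"
| "interp_trm arr (BarSum S) n =
     {(as, \<gamma>). length as = n \<and>
        (\<exists>I. I \<subseteq># image_mset (map_prod id (\<lambda>Q. interp_tst arr Q n)) S \<and>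
             (\<forall>(\<alpha>, X)\<in>#I. as \<in> X) \<and> Meet {#\<alpha>. (\<alpha>, X) \<in># I#} \<le> \<gamma>)}"
| "interp_tst arr (TSum S) n =
     {as. length as = n \<and> (\<exists>X\<in>#image_mset (\<lambda>Q. interp_tst arr Q n) S. as \<in> X)}"
| "interp_tst arr (TProd P) n =
     {as. length as = n \<and> (\<forall>X\<in>#image_mset (\<lambda>Q. interp_tst arr Q n) P. as \<in> X)}"
| "interp_tst arr (Tau \<alpha> M) n = {as. (as, \<alpha>) \<in> interp_trm arr M n}"

definition sensible :: "('d::bounded_semilattice_inf_top \<Rightarrow> 'd \<Rightarrow> 'd) \<Rightarrow>
      ('d \<Rightarrow> ('d \<times> 'd) set) \<Rightarrow> bool" where
  "sensible arr ext \<longleftrightarrow>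
     (\<forall>n M. is_trm n M \<longrightarrow>
        (\<not> conv_trm ext M \<longleftrightarrow> interp_trm arr M n = {(as, top) | as. length as = n})) \<and>
     (\<forall>n Q. is_tst n Q \<longrightarrow> (\<not> conv_tst ext Q \<longleftrightarrow> interp_tst arr Q n = {}))"

end

(* The term ebar \<alpha> denotes the principal filter of \<alpha>, exactly as a variable with value \<alpha> does.
   The interpretation is compositional, so substituting ebar (as ! i) for the i-th variable has
   the same effect as evaluating at the vector as.  The test tau \<beta> (inst M (map ebar as)) is
   closed, hence its interpretation contains at most the empty vector, and sensibility identifies
   its non-emptiness with convergence. *)
theory Submission
  imports Defs
begin

lemma subseteq_image_mset_iff: "I \<subseteq># image_mset f S \<longleftrightarrow> (\<exists>J. J \<subseteq># S \<and> I = image_mset f J)"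
proof
  assume "I \<subseteq># image_mset f S"
  then obtain K where "image_mset f S = I + K"
    by (auto simp: mset_subset_eq_exists_conv)
  then obtain J L where "S = J + L" "I = image_mset f J"
    by (metis image_mset_eq_plusD)
  then show "\<exists>J. J \<subseteq># S \<and> I = image_mset f J"
    using mset_subset_eq_add_left by blast
qed (auto intro: image_mset_subseteq_mono)

lemma subset_singleton_mset: "J \<subseteq># {#x#} \<longleftrightarrow> J = {#} \<or> J = {#x#}"
  by (cases J) auto

text \<open>The defining equation selects a submultiset of pairs of an index and a set of vectors.
  Lifting it along the image gives a choice of summands of \<open>S\<close> itself, the form that
  later arguments handle.\<close>

lemma interp_BarSum_iff:
  "(as, \<gamma>) \<in> interp_trm arr (BarSum S) n \<longleftrightarrow> length as = n \<and>
     (\<exists>J. J \<subseteq># S \<and> (\<forall>(\<alpha>, Q)\<in>#J. as \<in> interp_tst arr Q n) \<and> Meet (image_mset fst J) \<le> \<gamma>)"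
proof -
  let ?h = "map_prod id (\<lambda>Q. interp_tst arr Q n)"
  have "(as, \<gamma>) \<in> interp_trm arr (BarSum S) n \<longleftrightarrow> length as = n \<and>
      (\<exists>J. J \<subseteq># S \<and> (\<forall>(\<alpha>, X)\<in>#image_mset ?h J. as \<in> X) \<and>
        Meet {#\<alpha>. (\<alpha>, X) \<in># image_mset ?h J#} \<le> \<gamma>)"
    unfolding interp_trm.simps subseteq_image_mset_iff by blast
  also have "\<dots> \<longleftrightarrow> length as = n \<and>
      (\<exists>J. J \<subseteq># S \<and> (\<forall>(\<alpha>, Q)\<in>#J. as \<in> interp_tst arr Q n) \<and> Meet (image_mset fst J) \<le> \<gamma>)"
    by (simp add: multiset.map_comp comp_def split_beta)
  finally show ?thesis .
qed

text \<open>Here \<open>g\<close> stands for a renaming or a substitution acting on tests. It leaves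
  the indices alone, so corresponding choices of summands have the same meet and only the truth of
  the tests has to be compared.\<close>

lemma interp_BarSum_cong:
  assumes "length as = m" "length as' = n"
    and "\<And>\<alpha> Q. (\<alpha>, Q) \<in># S \<Longrightarrow> as \<in> interp_tst arr (g Q) m \<longleftrightarrow> as' \<in> interp_tst arr Q n"
  shows "(as, \<gamma>) \<in> interp_trm arr (BarSum (image_mset (map_prod id g) S)) m \<longleftrightarrow>
    (as', \<gamma>) \<in> interp_trm arr (BarSum S) n"
proof -
  have fst: "image_mset fst (image_mset (map_prod id g) J) = image_mset fst J" for J
    by (simp add: multiset.map_comp comp_def)
  have all: "(\<forall>(\<alpha>, Q)\<in>#image_mset (map_prod id g) J. as \<in> interp_tst arr Q m) \<longleftrightarrow>
      (\<forall>(\<alpha>, Q)\<in>#J. as' \<in> interp_tst arr Q n)" if "J \<subseteq># S" for J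
    using assms(3) mset_subset_eqD[OF that] by fastforce
  have "(\<exists>I. I \<subseteq># image_mset (map_prod id g) S \<and> (\<forall>(\<alpha>, Q)\<in>#I. as \<in> interp_tst arr Q m) \<and>
        Meet (image_mset fst I) \<le> \<gamma>) \<longleftrightarrow>
      (\<exists>J. J \<subseteq># S \<and> (\<forall>(\<alpha>, Q)\<in>#image_mset (map_prod id g) J. as \<in> interp_tst arr Q m) \<and>
        Meet (image_mset fst (image_mset (map_prod id g) J)) \<le> \<gamma>)"
    unfolding subseteq_image_mset_iff by blast
  also have "\<dots> \<longleftrightarrow> (\<exists>J. J \<subseteq># S \<and> (\<forall>(\<alpha>, Q)\<in>#J. as' \<in> interp_tst arr Q n) \<and>
        Meet (image_mset fst J) \<le> \<gamma>)"
    unfolding fst using all by blast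
  finally show ?thesis
    unfolding interp_BarSum_iff using assms(1,2) by simp
qed

lemma interp_Lam_cong:
  assumes "length as = m" "length as' = n"
    and "\<And>\<beta> \<gamma>. (\<beta> # as, \<gamma>) \<in> interp_trm arr M (Suc m) \<longleftrightarrow> (\<beta> # as', \<gamma>) \<in> interp_trm arr N (Suc n)"
  shows "(as, \<delta>) \<in> interp_trm arr (Lam M) m \<longleftrightarrow> (as', \<delta>) \<in> interp_trm arr (Lam N) n"
  using assms by simp

lemma interp_App_cong:
  assumes "\<And>\<gamma>. (as, \<gamma>) \<in> interp_trm arr M m \<longleftrightarrow> (as', \<gamma>) \<in> interp_trm arr M' n"
    and "\<And>\<gamma>. (as, \<gamma>) \<in> interp_trm arr N m \<longleftrightarrow> (as', \<gamma>) \<in> interp_trm arr N' n"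
  shows "(as, \<delta>) \<in> interp_trm arr (App M N) m \<longleftrightarrow> (as', \<delta>) \<in> interp_trm arr (App M' N') n"
  using assms by simp

lemma length_interp:
  "(as, \<beta>) \<in> interp_trm arr M n \<Longrightarrow> length as = n"
  "as \<in> interp_tst arr Q n \<Longrightarrow> length as = n"
  by (induction M and Q arbitrary: as \<beta> n and as n) auto

text \<open>The empty family witnesses every compound case, since \<open>Meet {#}\<close> is
  \<open>top\<close>.\<close>

lemma top_in_interp:
  assumes "is_trm n M" "length as = n"
  shows "(as, top) \<in> interp_trm arr M n"
  using assms
\<comment> \<open>Tests need no claim: for a \<open>BarSum\<close> the empty choice of summands is
  enough.\<close>
proof (induction M arbitrary: n as rule: trm.induct[where ?P2.0 = "\<lambda>_. True"])
  case (Lam M)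
  then show ?case by (auto simp: Meet_def intro!: exI[of _ "{#}"])
next
  case (App M N)
  from App.prems(1) have "is_trm n M" "is_trm n N" by (auto elim: is_trm.cases)
  with App show ?case by (auto simp: Meet_def intro!: exI[of _ "{#}"])
next
  case (BarSum S)
  then show ?case by (auto simp: interp_BarSum_iff intro!: exI[of _ "{#}"])
qed (auto elim: is_trm.cases)

text \<open>The vector \<open>as'\<close> is \<open>as\<close> read through \<open>r\<close>. Under
  a binder the lifted renaming fixes index 0 and both vectors receive the same new head, so this
  relation persists.\<close>

lemma interp_rename:
  "is_trm n M \<Longrightarrow> (\<And>i. i < n \<Longrightarrow> r i < m \<and> as ! r i = as' ! i) \<Longrightarrow> length as = m \<Longrightarrow>
    length as' = n \<Longrightarrow>
    (as, \<beta>) \<in> interp_trm arr (rename_trm M r) m \<longleftrightarrow> (as', \<beta>) \<in> interp_trm arr M n"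
  "is_tst n Q \<Longrightarrow> (\<And>i. i < n \<Longrightarrow> r i < m \<and> as ! r i = as' ! i) \<Longrightarrow> length as = m \<Longrightarrow>
    length as' = n \<Longrightarrow>
    as \<in> interp_tst arr (rename_tst Q r) m \<longleftrightarrow> as' \<in> interp_tst arr Q n"
proof (induction arbitrary: m r as as' \<beta> and m r as as' rule: is_trm_is_tst.inducts)
  case (2 n M)
  have "(\<gamma> # as, \<delta>) \<in> interp_trm arr (rename_trm M (case_nat 0 (Suc \<circ> r))) (Suc m) \<longleftrightarrow>
      (\<gamma> # as', \<delta>) \<in> interp_trm arr M (Suc n)" for \<gamma> \<delta>
    by (rule "2.IH") (use "2.prems" in \<open>auto split: nat.split\<close>)
  then show ?case
    unfolding rename_trm.simps using "2.prems" by (intro interp_Lam_cong)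
next
  case (3 n M N)
  show ?case
    unfolding rename_trm.simps by (intro interp_App_cong "3.IH" "3.prems")
next
  case (4 S n)
  show ?case
    unfolding rename_trm.simps
    by (intro interp_BarSum_cong "4.prems") (use "4.IH" "4.prems" in blast)
next
  case (5 S n)
  have "as \<in> interp_tst arr (rename_tst Q r) m \<longleftrightarrow> as' \<in> interp_tst arr Q n" if "Q \<in># S" for Q
    using "5.IH"[OF that] "5.prems" by blast
  then show ?case using "5.prems" by simp
next
  case (6 S n)
  have "as \<in> interp_tst arr (rename_tst Q r) m \<longleftrightarrow> as' \<in> interp_tst arr Q n" if "Q \<in># S" for Q
    using "6.IH"[OF that] "6.prems" by blast
  then show ?case using "6.prems" by simp
qed auto

text \<open>Variables are terms, so replacing them cannot change the outermost constructor of a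
  test. Hence the side conditions of \<open>is_tst\<close> on summands and factors survive.\<close>

lemma is_sum_rename [simp]: "is_sum (rename_tst Q r) \<longleftrightarrow> is_sum Q"
  and is_prod_rename [simp]: "is_prod (rename_tst Q r) \<longleftrightarrow> is_prod Q"
  and is_sum_subst [simp]: "is_sum (subst_tst Q s) \<longleftrightarrow> is_sum Q"
  and is_prod_subst [simp]: "is_prod (subst_tst Q s) \<longleftrightarrow> is_prod Q"
  by (cases Q; simp)+

lemma is_trm_rename:
  \<comment> \<open>No variable shared by the two claims ties their carriers together, and the
    mutual induction needs a single type.\<close>
  fixes M :: "'d::bounded_semilattice_inf_top trm" and Q :: "'d tst"
  shows
  "is_trm n M \<Longrightarrow> (\<And>i. i < n \<Longrightarrow> r i < m) \<Longrightarrow> is_trm m (rename_trm M r)"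
  "is_tst n Q \<Longrightarrow> (\<And>i. i < n \<Longrightarrow> r i < m) \<Longrightarrow> is_tst m (rename_tst Q r)"
proof (induction arbitrary: m r and m r rule: is_trm_is_tst.inducts)
  case (2 n M)
  have "is_trm (Suc m) (rename_trm M (case_nat 0 (Suc \<circ> r)))"
    by (rule "2.IH") (use "2.prems" in \<open>auto split: nat.split\<close>)
  then show ?case by (simp add: is_trm_is_tst.intros)
qed (auto intro!: is_trm_is_tst.intros, blast+)

lemma is_trm_up:
  assumes "\<And>i. i < n \<Longrightarrow> is_trm m (s i)" "i < Suc n"
  shows "is_trm (Suc m) (up s i)"
  using assms by (auto simp: up_def split: nat.split intro: is_trm_is_tst.intros is_trm_rename)

lemma is_trm_subst:
  "is_trm n M \<Longrightarrow> (\<And>i. i < n \<Longrightarrow> is_trm m (s i)) \<Longrightarrow> is_trm m (subst_trm M s)"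
  "is_tst n Q \<Longrightarrow> (\<And>i. i < n \<Longrightarrow> is_trm m (s i)) \<Longrightarrow> is_tst m (subst_tst Q s)"
proof (induction arbitrary: m s and m s rule: is_trm_is_tst.inducts)
  case (2 n M)
  have "is_trm (Suc m) (subst_trm M (up s))"
    using "2.prems" by (intro "2.IH" is_trm_up)
  then show ?case by (simp add: is_trm_is_tst.intros)
qed (auto intro!: is_trm_is_tst.intros, blast+)

text \<open>At the one vector \<open>as\<close>, each \<open>s i\<close> is assumed to denote the
  principal filter of \<open>as' ! i\<close>, which is what \<open>Var i\<close> denotes at
  \<open>as'\<close>. Principality lets a single vector \<open>as'\<close> serve the whole
  induction.\<close>

lemma interp_subst:
  "is_trm n M \<Longrightarrow> (\<And>i. i < n \<Longrightarrow> is_trm m (s i)) \<Longrightarrow>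
    (\<And>i \<gamma>. i < n \<Longrightarrow> (as, \<gamma>) \<in> interp_trm arr (s i) m \<longleftrightarrow> as' ! i \<le> \<gamma>) \<Longrightarrow> length as = m \<Longrightarrow>
    length as' = n \<Longrightarrow>
    (as, \<beta>) \<in> interp_trm arr (subst_trm M s) m \<longleftrightarrow> (as', \<beta>) \<in> interp_trm arr M n"
  "is_tst n Q \<Longrightarrow> (\<And>i. i < n \<Longrightarrow> is_trm m (s i)) \<Longrightarrow>
    (\<And>i \<gamma>. i < n \<Longrightarrow> (as, \<gamma>) \<in> interp_trm arr (s i) m \<longleftrightarrow> as' ! i \<le> \<gamma>) \<Longrightarrow> length as = m \<Longrightarrow>
    length as' = n \<Longrightarrow>
    as \<in> interp_tst arr (subst_tst Q s) m \<longleftrightarrow> as' \<in> interp_tst arr Q n"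
proof (induction arbitrary: m s as as' \<beta> and m s as as' rule: is_trm_is_tst.inducts)
  case (2 n M)
  have "(\<gamma> # as, \<delta>) \<in> interp_trm arr (up s i) (Suc m) \<longleftrightarrow> (\<gamma> # as') ! i \<le> \<delta>"
    if "i < Suc n" for \<gamma> \<delta> i
  proof (cases i)
    case 0
    \<comment> \<open>\<open>up s 0\<close> is \<open>Var 0\<close>, whose value is the new head
      \<open>\<gamma>\<close>.\<close>
    then show ?thesis using "2.prems" by (simp add: up_def)
  next
    case (Suc j)
    \<comment> \<open>Weakening: renaming by \<open>Suc\<close> skips the head, because
      \<open>(\<gamma> # as) ! Suc k = as ! k\<close>.\<close>
    then have "(\<gamma> # as, \<delta>) \<in> interp_trm arr (rename_trm (s j) Suc) (Suc m) \<longleftrightarrow>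
        (as, \<delta>) \<in> interp_trm arr (s j) m"
      using that "2.prems" by (intro interp_rename) auto
    then show ?thesis using that Suc "2.prems" by (simp add: up_def)
  qed
  then have "(\<gamma> # as, \<delta>) \<in> interp_trm arr (subst_trm M (up s)) (Suc m) \<longleftrightarrow>
      (\<gamma> # as', \<delta>) \<in> interp_trm arr M (Suc n)" for \<gamma> \<delta>
    using "2.prems" by (intro "2.IH" is_trm_up) auto
  then show ?case
    unfolding subst_trm.simps using "2.prems" by (intro interp_Lam_cong)
next
  case (3 n M N)
  show ?case
    unfolding subst_trm.simps by (intro interp_App_cong "3.IH" "3.prems")
next
  case (4 S n)
  show ?case
    unfolding subst_trm.simps
    by (intro interp_BarSum_cong "4.prems") (use "4.IH" "4.prems" in blast)
next
  case (5 S n)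
  have "as \<in> interp_tst arr (subst_tst Q s) m \<longleftrightarrow> as' \<in> interp_tst arr Q n" if "Q \<in># S" for Q
    using "5.IH"[OF that] "5.prems" by blast
  then show ?case using "5.prems" by simp
next
  case (6 S n)
  have "as \<in> interp_tst arr (subst_tst Q s) m \<longleftrightarrow> as' \<in> interp_tst arr Q n" if "Q \<in># S" for Q
    using "6.IH"[OF that] "6.prems" by blast
  then show ?case using "6.prems" by simp
qed auto

lemma is_trm_ebar: "is_trm n (ebar \<alpha>)"
  by (auto simp: ebar_def barsum_def intro!: is_trm_is_tst.intros)

text \<open>The test \<open>eps\<close> holds at every vector of the right length, so only the index
  of the summand matters. For \<open>\<alpha> = top\<close> the sum is empty and its values are
  those above \<open>top\<close>.\<close>

lemma interp_ebar:
  "(as, \<gamma>) \<in> interp_trm arr (ebar \<alpha>) n \<longleftrightarrow> length as = n \<and> \<alpha> \<le> \<gamma>"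
proof (cases "\<alpha> = top")
  case True
  then show ?thesis by (simp add: ebar_def barsum_def Meet_def)
next
  case False
  then have ebar: "ebar \<alpha> = BarSum {#(\<alpha>, eps)#}" by (simp add: ebar_def barsum_def)
  \<comment> \<open>The left disjunct comes from choosing no summand, the right one from choosing
    the only summand.\<close>
  have "top \<le> \<gamma> \<or> \<alpha> \<le> \<gamma> \<longleftrightarrow> \<alpha> \<le> \<gamma>"
    using order_trans[OF top_greatest] by blast
  then show ?thesis
    unfolding ebar interp_BarSum_iff subset_singleton_mset
    by (auto simp: Meet_def conj_disj_distribR ex_disj_distrib)
qed

lemma conv_eps: "conv_tst ext eps"
proof -
  have "hn_prod eps"
    unfolding hn_prod_def by (intro exI[of _ "{#}"]) (simp add: tprod_def)
  then have "mhnf_tst eps"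
    \<comment> \<open>The remainder is the empty sum: \<open>tsum\<close> drops it and collapses the
      singleton left over to \<open>eps\<close>.\<close>
    unfolding mhnf_tst_def by (intro exI[of _ eps] exI[of _ "TSum {#}"]) (simp add: tsum_def)
  then show ?thesis unfolding conv_tst_def by blast
qed

theorem mainTheorem3:
  fixes arr :: "'d::bounded_semilattice_inf_top \<Rightarrow> 'd \<Rightarrow> 'd"
    and ext :: "'d \<Rightarrow> ('d \<times> 'd) set"
    and M :: "'d trm" and n :: nat and as :: "'d list" and \<beta> :: 'd
  assumes "DEFiM arr ext"
    and "sensible arr ext"
    and "is_trm n M"
    and "length as = n"
  shows "(as, \<beta>) \<in> interp_trm arr M n \<longleftrightarrow> conv_tst ext (tau \<beta> (inst M (map ebar as)))"
proof (cases "\<beta> = top")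
  case True
  \<comment> \<open>Both sides are true: \<open>tau top\<close> yields \<open>eps\<close>, and
    \<open>top\<close> lies in every interpretation.\<close>
  then show ?thesis using assms(3,4) by (simp add: tau_def conv_eps top_in_interp)
next
  case False
  let ?M = "inst M (map ebar as)"
  \<comment> \<open>All free indices of \<open>M\<close> are below \<open>length as\<close>, so
    \<open>inst\<close> replaces each of them by a closed term.\<close>
  have "is_trm 0 ?M"
    unfolding inst_def using assms(4) by (intro is_trm_subst(1)[OF assms(3)]) (simp add: is_trm_ebar)
  with False have "is_tst 0 (Tau \<beta> ?M)" by (intro is_trm_is_tst.intros)
  with assms(2) have "conv_tst ext (Tau \<beta> ?M) \<longleftrightarrow> interp_tst arr (Tau \<beta> ?M) 0 \<noteq> {}"
    unfolding sensible_def by blast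
  also have "\<dots> \<longleftrightarrow> ([], \<beta>) \<in> interp_trm arr ?M 0"
    \<comment> \<open>The only vector of length 0 is \<open>[]\<close>, so non-emptiness is
      membership of \<open>[]\<close>.\<close>
    using length_interp(1)[where n = 0] by fastforce
  also have "\<dots> \<longleftrightarrow> (as, \<beta>) \<in> interp_trm arr M n"
    \<comment> \<open>Substitution is applied with \<open>[]\<close> as the outer vector and
      \<open>as\<close> as the vector of values; \<open>interp_ebar\<close> supplies the principal
      filters.\<close>
    unfolding inst_def using assms(4)
    by (intro interp_subst(1)[OF assms(3)]) (simp_all add: is_trm_ebar interp_ebar)
  finally show ?thesis using False by (simp add: tau_def)
qed

end
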